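(* For every integer $n \geq 5$, the number of permutations $\pi$ of $\{1,2,\dots,n\}$ which contain exactly one occurrence of the pattern $132$ and exactly one occurrence of the pattern $123$ equals $(n-3)(n-4)2^{n-5}$.
   Context: A permutation $\pi$ of $\{1,\dots,n\}$ is written as the sequence $\pi(1)\pi(2)\cdots\pi(n)$. An occurrence of the pattern $123$ in $\pi$ is a triple of indices $i<j<k$ with $\pi(i)<\pi(j)<\pi(k)$. An occurrence of the pattern $132$ in $\pi$ is a triple of indices $i<j<k$ with $\pi(i)<\pi(k)<\pi(j)$. *)

theory Defs
  imports Main "HOL-Combinatorics.Permutations"
begin

definition occurrences_123 :: "nat \<Rightarrow> (nat \<Rightarrow> nat) \<Rightarrow> (nat \<times> nat \<times> nat) set" where
  "occurrences_123 n \<pi> =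
     {(i, j, k). i \<in> {1..n} \<and> j \<in> {1..n} \<and> k \<in> {1..n} \<and>
                 i < j \<and> j < k \<and> \<pi> i < \<pi> j \<and> \<pi> j < \<pi> k}"

definition occurrences_132 :: "nat \<Rightarrow> (nat \<Rightarrow> nat) \<Rightarrow> (nat \<times> nat \<times> nat) set" where
  "occurrences_132 n \<pi> =
     {(i, j, k). i \<in> {1..n} \<and> j \<in> {1..n} \<and> k \<in> {1..n} \<and>
                 i < j \<and> j < k \<and> \<pi> i < \<pi> k \<and> \<pi> k < \<pi> j}"

end

theory Submission
  imports Defs "HOL-Combinatorics.Multiset_Permutations"
begin

text \<open>
  Read a permutation from right to left. An entry with \<open>c\<close> larger entries to its right is the
  smallest entry of exactly \<open>c choose 2\<close> occurrences of 123 and 132 together, so exactly two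
  entries have \<open>c = 2\<close> and all others have \<open>c \<le> 1\<close>. For \<open>c = 2\<close> the occurrence is a 123 iff
  the two largest entries to the right are in ascending order; this order becomes descending
  after an entry with \<open>c = 0\<close>, ascending after one with \<open>c = 1\<close>, and is unchanged otherwise.
  Hence the numbers of words, refined by this order, satisfy a linear recurrence in the length.
\<close>

section \<open>Pattern counts as recursions on lists\<close>

fun pairs :: "('a \<Rightarrow> 'a \<Rightarrow> bool) \<Rightarrow> 'a list \<Rightarrow> nat" where
  "pairs R [] = 0"
| "pairs R (x # xs) = length (filter (R x) xs) + pairs R xs"

text \<open>Both patterns start with their smallest entry, so one recursion on the head serves both:
  \<open>R\<close> is \<open><\<close> for 123 and \<open>>\<close> for 132.\<close>

fun occ :: "(nat \<Rightarrow> nat \<Rightarrow> bool) \<Rightarrow> nat list \<Rightarrow> nat" where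
  "occ R [] = 0"
| "occ R (x # xs) = pairs R (filter ((<) x) xs) + occ R xs"

text \<open>Whether the two largest entries are in ascending order.\<close>

fun asc :: "nat list \<Rightarrow> bool" where
  "asc [] = False"
| "asc (x # xs) = (case length (filter ((<) x) xs) of 0 \<Rightarrow> False | Suc 0 \<Rightarrow> True | _ \<Rightarrow> asc xs)"

section \<open>Transfer from index triples of a permutation to its list of values\<close>

lemma length_filter_map_upt:
  "length (filter P (map f [m..<n])) = card {k. m \<le> k \<and> k < n \<and> P (f k)}"
proof -
  have "length (filter P (map f [m..<n])) = card (set (filter (\<lambda>k. P (f k)) [m..<n]))"
    by (subst distinct_card) (simp_all add: filter_map comp_def)
  also have "set (filter (\<lambda>k. P (f k)) [m..<n]) = {k. m \<le> k \<and> k < n \<and> P (f k)}"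
    by auto
  finally show ?thesis .
qed

text \<open>The recursion peels off the head, so the index pairs are split by whether the first
  index is \<open>m\<close>. The filter \<open>P\<close> is carried along because \<open>occ\<close>
  calls \<open>pairs\<close> on the entries above its head.\<close>

lemma pairs_filter_map_upt:
  "pairs R (filter P (map f [m..<n])) =
     card {(j, k). m \<le> j \<and> j < k \<and> k < n \<and> P (f j) \<and> P (f k) \<and> R (f j) (f k)}"
    (is "_ = card (?S m)")
proof (induction "n - m" arbitrary: m)
  case 0
  then have "?S m = {}" by auto
  with 0 show ?case by (simp only: card.empty) simp
next
  case (Suc d)
  let ?K = "{k. Suc m \<le> k \<and> k < n \<and> P (f k) \<and> R (f m) (f k)}"
  have "m < n" "d = n - Suc m"
    using Suc.hyps(2) by auto
  have split: "?S m = (if P (f m) then Pair m ` ?K else {}) \<union> ?S (Suc m)"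
  proof (intro set_eqI, clarify)
    fix j k
    show "(j, k) \<in> ?S m \<longleftrightarrow> (j, k) \<in> (if P (f m) then Pair m ` ?K else {}) \<union> ?S (Suc m)"
      by (cases "j = m") (auto simp: Suc_le_eq)
  qed
  have "finite (?S (Suc m))"
    by (rule finite_subset[of _ "{..<n} \<times> {..<n}"]) auto
  then have "card (?S m) = card (if P (f m) then Pair m ` ?K else {}) + card (?S (Suc m))"
    unfolding split by (intro card_Un_disjoint) auto
  also have "card (if P (f m) then Pair m ` ?K else {}) = (if P (f m) then card ?K else 0)"
    by (simp add: card_image inj_on_def)
  also have "card ?K = length (filter (R (f m)) (filter P (map f [Suc m..<n])))"
    using length_filter_map_upt[of "\<lambda>y. P y \<and> R (f m) y" f "Suc m" n]
    by (simp only: filter_filter)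
  also have "card (?S (Suc m)) = pairs R (filter P (map f [Suc m..<n]))"
    using Suc.hyps(1)[OF \<open>d = n - Suc m\<close>] by (rule sym)
  finally show ?case
    using \<open>m < n\<close> by (simp add: upt_conv_Cons)
qed

lemma occ_map_upt:
  "occ R (map f [m..<n]) =
     card {(i, j, k). m \<le> i \<and> i < j \<and> j < k \<and> k < n \<and> f i < f j \<and> f i < f k \<and> R (f j) (f k)}"
    (is "_ = card (?S m)")
proof (induction "n - m" arbitrary: m)
  case 0
  then have "?S m = {}" by auto
  with 0 show ?case by (simp only: card.empty) simp
next
  case (Suc d)
  let ?K = "{(j, k). Suc m \<le> j \<and> j < k \<and> k < n \<and> f m < f j \<and> f m < f k \<and> R (f j) (f k)}"
  have "m < n" "d = n - Suc m"
    using Suc.hyps(2) by auto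
  have split: "?S m = Pair m ` ?K \<union> ?S (Suc m)"
  proof (intro set_eqI, clarify)
    fix i j k
    show "(i, j, k) \<in> ?S m \<longleftrightarrow> (i, j, k) \<in> Pair m ` ?K \<union> ?S (Suc m)"
      by (cases "i = m") (auto simp: Suc_le_eq)
  qed
  have "finite (?S (Suc m))"
    by (rule finite_subset[of _ "{..<n} \<times> {..<n} \<times> {..<n}"]) auto
  moreover have "finite ?K"
    by (rule finite_subset[of _ "{..<n} \<times> {..<n}"]) auto
  ultimately have "card (?S m) = card (Pair m ` ?K) + card (?S (Suc m))"
    unfolding split by (intro card_Un_disjoint) auto
  also have "card (Pair m ` ?K) = card ?K"
    by (simp add: card_image inj_on_def)
  also have "card ?K = pairs R (filter ((<) (f m)) (map f [Suc m..<n]))"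
    by (rule pairs_filter_map_upt[symmetric])
  also have "card (?S (Suc m)) = occ R (map f [Suc m..<n])"
    using Suc.hyps(1)[OF \<open>d = n - Suc m\<close>] by (rule sym)
  finally show ?case
    using \<open>m < n\<close> by (simp add: upt_conv_Cons)
qed

text \<open>\<open>occ_map_upt\<close> asks both later entries to exceed the first; in each pattern
  one of these comparisons follows by transitivity.\<close>

lemma card_occurrences:
  "card (occurrences_123 n \<pi>) = occ (<) (map \<pi> [1..<Suc n])"
  "card (occurrences_132 n \<pi>) = occ (>) (map \<pi> [1..<Suc n])"
  unfolding occ_map_upt occurrences_123_def occurrences_132_def
  by (rule arg_cong[of _ _ card]; force)+

text \<open>Injective because a permutation of \<open>{1..n}\<close> fixes everything outside;
  surjective because both sides have \<open>n!\<close> elements.\<close>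

lemma bij_betw_permutes_lists:
  "bij_betw (\<lambda>\<pi>. map \<pi> [1..<Suc n]) {\<pi>. \<pi> permutes {1..n}} (permutations_of_set {1..n})"
proof -
  let ?F = "\<lambda>\<pi>. map \<pi> [1..<Suc n]" and ?P = "{\<pi>. \<pi> permutes {1..n}}"
  have upt: "set [1..<Suc n] = {1..n}"
    by auto
  have inj: "inj_on ?F ?P"
  proof (rule inj_onI)
    fix f g
    assume "f \<in> ?P" "g \<in> ?P" "?F f = ?F g"
    then have "f i = g i" for i
      by (cases "i \<in> {1..n}") (auto simp: permutes_not_in map_eq_conv upt simp del: upt_Suc)
    then show "f = g" by blast
  qed
  have "?F \<pi> \<in> permutations_of_set {1..n}" if "\<pi> permutes {1..n}" for \<pi>
  proof (rule permutations_of_setI)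
    show "set (?F \<pi>) = {1..n}"
      using permutes_image[OF that] by (simp only: set_map upt)
    show "distinct (?F \<pi>)"
      using permutes_inj_on[OF that] by (simp add: distinct_map del: upt_Suc)
  qed
  then have sub: "?F ` ?P \<subseteq> permutations_of_set {1..n}"
    by blast
  have "card (?F ` ?P) = card (permutations_of_set {1..n})"
    by (simp add: card_image[OF inj] card_permutations[OF refl] del: upt_Suc One_nat_def)
  with sub have "?F ` ?P = permutations_of_set {1..n}"
    by (intro card_subset_eq) auto
  with inj show ?thesis
    by (simp add: bij_betw_def)
qed

section \<open>Occurrences that start at a given entry\<close>

lemma pairs_less_plus_greater:
  "distinct xs \<Longrightarrow> pairs (<) xs + pairs (>) xs = length xs choose 2" for xs :: "nat list"
proof (induction xs)
  case (Cons x xs)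
  have "length (filter ((<) x) xs) + length (filter ((>) x) xs) = length xs"
    using Cons.prems sum_length_filter_compl[of "(<) x" xs]
    by (metis (no_types, lifting) distinct.simps(2) filter_cong linorder_less_linear order_less_imp_not_less)
  with Cons show ?case
    by (simp add: numeral_2_eq_2)
qed simp

text \<open>The entries above \<open>x\<close> are the largest of the list, so if only
  \<open>u\<close> and \<open>v\<close> exceed \<open>x\<close>, they are the two that
  \<open>asc\<close> compares.\<close>

lemma less_iff_asc:
  "distinct xs \<Longrightarrow> filter ((<) x) xs = [u, v] \<Longrightarrow> u < v \<longleftrightarrow> asc xs"
proof (induction xs)
  case (Cons y ys)
  show ?case
  proof (cases "x < y")
    case True
    then have y: "u = y" "filter ((<) x) ys = [v]"
      using Cons.prems by auto
    then have "v \<in> set (filter ((<) x) ys)"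
      by simp
    then have "v \<noteq> y"
      using Cons.prems by auto
    \<comment> \<open>Whatever exceeds \<open>y\<close> exceeds \<open>x\<close>, so only
      \<open>v\<close> can remain: the length is 1 if \<open>y < v\<close> and 0 otherwise.\<close>
    have "filter ((<) y) ys = filter ((<) y) (filter ((<) x) ys)"
      unfolding filter_filter using True by (intro filter_cong) auto
    with y \<open>v \<noteq> y\<close> show ?thesis
      by (auto split: nat.splits)
  next
    case False
    with Cons.prems have xs: "filter ((<) x) ys = [u, v]"
      by simp
    \<comment> \<open>Since \<open>y \<le> x\<close>, both \<open>u\<close> and \<open>v\<close>
      exceed \<open>y\<close>; hence \<open>asc\<close> skips \<open>y\<close> and the induction
      hypothesis applies.\<close>
    have "filter ((<) x) ys = filter ((<) x) (filter ((<) y) ys)"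
      unfolding filter_filter using False by (intro filter_cong) auto
    then have "length [u, v] \<le> length (filter ((<) y) ys)"
      by (metis xs length_filter_le)
    with Cons xs show ?thesis
      by (auto split: nat.splits)
  qed
qed simp

lemma pairs_le_one:
  assumes "length ys \<le> 1"
  shows "pairs R ys = 0"
  using assms by (cases ys) auto

text \<open>At least three pairs cannot be shared between two orders with at most one each. So an
  entry with three larger ones to its right repeats a pattern.\<close>

lemma pairs_three:
  fixes ys :: "nat list"
  assumes "distinct ys" "length ys \<ge> 3"
  shows "pairs (<) ys > 1 \<or> pairs (>) ys > 1"
proof -
  have three: "(3 choose 2 :: nat) = 3"
    by (simp add: numeral_eq_Suc)
  have "(3 choose 2 :: nat) \<le> length ys choose 2"
    using assms by (intro binomial_right_mono)
  then show ?thesis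
    using pairs_less_plus_greater[OF assms(1)] three by linarith
qed

section \<open>Recurrence and closed form for the number of words\<close>

definition words :: "nat set \<Rightarrow> bool \<Rightarrow> nat \<Rightarrow> nat \<Rightarrow> nat list set" where
  "words A s p q =
     {xs \<in> permutations_of_set A. asc xs = s \<and> occ (<) xs = p \<and> occ (>) xs = q}"

lemma finite_words: "finite (words A s p q)"
  by (simp add: words_def)

text \<open>The number of words of length \<open>k + 2\<close>.\<close>

fun num_words :: "nat \<Rightarrow> bool \<Rightarrow> nat \<Rightarrow> nat \<Rightarrow> nat" where
  "num_words 0 s p q = (if p = 0 \<and> q = 0 then 1 else 0)"
| "num_words (Suc k) s p q = num_words k True p q + num_words k False p q +
     (if s then (if p = 0 then 0 else num_words k s (p - 1) q)
      else (if q = 0 then 0 else num_words k s p (q - 1)))"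

abbreviation larger :: "nat set \<Rightarrow> nat \<Rightarrow> nat" where
  "larger A x \<equiv> card {y \<in> A. x < y}"

text \<open>This is the rank counted from the top, so each value below \<open>card A\<close> belongs
  to exactly one possible first entry.\<close>

lemma bij_betw_larger:
  assumes "finite A"
  shows "bij_betw (larger A) A {..<card A}"
proof -
  have mono: "larger A y < larger A x" if "x < y" "y \<in> A" for x y
    using assms that by (intro psubset_card_mono) auto
  have inj: "inj_on (larger A) A"
    by (rule linorder_inj_onI) (use mono in \<open>force+\<close>)
  have "larger A ` A \<subseteq> {..<card A}"
    using assms by (auto intro!: psubset_card_mono)
  then have "larger A ` A = {..<card A}"
    using inj by (intro card_subset_eq) (auto simp: card_image)
  with inj show ?thesis
    by (simp add: bij_betw_def)
qed

lemma length_filter_permutation: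
  assumes "xs \<in> permutations_of_set (A - {x})"
  shows "length (filter ((<) x) xs) = larger A x"
proof -
  have "length (filter ((<) x) xs) = card (set (filter ((<) x) xs))"
    using assms by (intro distinct_card[symmetric]) (auto dest: permutations_of_setD)
  also have "set (filter ((<) x) xs) = {y \<in> A. x < y}"
    using permutations_of_setD(1)[OF assms] by auto
  finally show ?thesis .
qed

text \<open>Rank 0 or 1 adds no occurrence and resets the state, whatever the state \<open>t\<close>
  of the tail. Rank 2 keeps the state and adds one occurrence of the type it dictates. Higher ranks
  violate the bounds on \<open>p\<close> and \<open>q\<close>.\<close>

lemma Cons_in_words_iff:
  assumes xs: "xs \<in> permutations_of_set (A - {x})" and "x \<in> A" "p \<le> 1" "q \<le> 1"
  shows "x # xs \<in> words A s p q \<longleftrightarrow>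
    (larger A x \<le> 1 \<and> s = (larger A x = 1) \<and> (\<exists>t. xs \<in> words (A - {x}) t p q)) \<or>
    (larger A x = 2 \<and> (if s then p \<noteq> 0 \<and> xs \<in> words (A - {x}) s (p - 1) q
                            else q \<noteq> 0 \<and> xs \<in> words (A - {x}) s p (q - 1)))"
proof -
  let ?ys = "filter ((<) x) xs"
  have len: "length ?ys = larger A x"
    using length_filter_permutation[OF xs] .
  have dist: "distinct xs" "distinct ?ys"
    using xs by (auto dest: permutations_of_setD)
  have mem: "x # xs \<in> permutations_of_set A"
    using xs \<open>x \<in> A\<close> by (auto simp: permutations_of_set_def)
  have asc: "asc (x # xs) \<longleftrightarrow> larger A x = 1 \<or> larger A x \<ge> 2 \<and> asc xs"
    using len by (auto split: nat.splits)
  have words_Cons: "x # xs \<in> words A s p q \<longleftrightarrow> asc (x # xs) = s \<and>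
      pairs (<) ?ys + occ (<) xs = p \<and> pairs (>) ?ys + occ (>) xs = q"
    using mem by (simp add: words_def del: asc.simps)
  have words_tl: "xs \<in> words (A - {x}) t p' q' \<longleftrightarrow> asc xs = t \<and> occ (<) xs = p' \<and> occ (>) xs = q'" for t p' q'
    using xs by (simp add: words_def)
  consider "larger A x \<le> 1" | "larger A x = 2" | "larger A x \<ge> 3"
    by linarith
  then show ?thesis
  proof cases
    case 1
    then have "pairs R ?ys = 0" for R
      by (metis pairs_le_one len)
    with 1 show ?thesis
      unfolding words_Cons words_tl asc by auto
  next
    case 2
    then obtain u v where uv: "?ys = [u, v]"
      using len by (auto simp: numeral_2_eq_2 length_Suc_conv)
    then have "u < v \<longleftrightarrow> asc xs" "u \<noteq> v"
      using less_iff_asc[OF dist(1)] dist(2) by auto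
    then have "pairs (<) ?ys = of_bool (asc xs)" "pairs (>) ?ys = of_bool (\<not> asc xs)"
      unfolding uv by auto
    with 2 show ?thesis
      unfolding words_Cons words_tl asc by (cases "asc xs") auto
  next
    case 3
    then have "pairs (<) ?ys > 1 \<or> pairs (>) ?ys > 1"
      using pairs_three[OF dist(2)] len by simp
    with 3 \<open>p \<le> 1\<close> \<open>q \<le> 1\<close> show ?thesis
      unfolding words_Cons by auto
  qed
qed

text \<open>Only two first entries are possible for a given \<open>s\<close>: the one that resets
  the state to \<open>s\<close>, and the one of rank 2. The hypothesis on \<open>f\<close> covers
  every set \<open>B\<close> of size \<open>m\<close>, since the tail lives on \<open>A\<close>
  minus its head.\<close>

lemma card_words_step:
  assumes A: "finite A" "card A = Suc m" "m \<ge> 2" and pq: "p \<le> 1" "q \<le> 1"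
    and IH: "\<And>B s p q. finite B \<Longrightarrow> card B = m \<Longrightarrow> p \<le> 1 \<Longrightarrow> q \<le> 1 \<Longrightarrow>
               card (words B s p q) = f s p q"
  shows "card (words A s p q) = f True p q + f False p q +
     (if s then (if p = 0 then 0 else f s (p - 1) q) else (if q = 0 then 0 else f s p (q - 1)))"
proof -
  define W where "W x = {xs \<in> permutations_of_set (A - {x}). x # xs \<in> words A s p q}" for x
  have finW: "finite (W x)" for x
    by (simp add: W_def)
  have ex: "\<exists>x\<in>A. larger A x = c" if "c < card A" for c
  proof -
    have "c \<in> larger A ` A"
      unfolding bij_betw_imp_surj_on[OF bij_betw_larger[OF A(1)]] using that by simp
    then show ?thesis by blast
  qed
  \<comment> \<open>\<open>x\<close> is the resetting entry and \<open>z\<close> the one of rank 2,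
    which exists because \<open>m \<ge> 2\<close>.\<close>
  have "(if s then 1 else 0) < card A" "2 < card A"
    using A by auto
  from this[THEN ex] obtain x z where x: "x \<in> A" "larger A x = (if s then 1 else 0)"
    and z: "z \<in> A" "larger A z = 2"
    by blast
  have eq: "y = y'" if "larger A y = larger A y'" "y \<in> A" "y' \<in> A" for y y'
    using bij_betw_imp_inj_on[OF bij_betw_larger[OF A(1)]] that by (rule inj_onD)
  have "x \<noteq> z"
    using x z by (auto split: if_splits)
  have cardB: "finite (A - {y})" "card (A - {y}) = m" if "y \<in> A" for y
    using A that by auto
  have perms: "permutations_of_set A = (\<Union>y\<in>A. (#) y ` permutations_of_set (A - {y}))"
    using A by (intro permutations_of_set_nonempty) auto
  have "words A s p q = (\<Union>y\<in>A. (#) y ` W y)"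
  proof (intro equalityI subsetI)
    fix xs
    assume xs: "xs \<in> words A s p q"
    then have "xs \<in> permutations_of_set A"
      by (simp add: words_def)
    then obtain y ys where "y \<in> A" "ys \<in> permutations_of_set (A - {y})" "xs = y # ys"
      unfolding perms by blast
    with xs show "xs \<in> (\<Union>y\<in>A. (#) y ` W y)"
      unfolding W_def by blast
  qed (auto simp: W_def)
  then have "card (words A s p q) = (\<Sum>y\<in>A. card ((#) y ` W y))"
    by (simp only:) (rule card_UN_disjoint; use A finW in auto)
  also have "\<dots> = (\<Sum>y\<in>A. card (W y))"
    by (intro sum.cong refl card_image) auto
  also have "\<dots> = (\<Sum>y\<in>{x, z}. card (W y))"
  proof (rule sum.mono_neutral_right)
    show "\<forall>y\<in>A - {x, z}. card (W y) = 0"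
    proof
      fix y
      assume y: "y \<in> A - {x, z}"
      then have "larger A y \<noteq> larger A x" "larger A y \<noteq> larger A z"
        using eq[OF _ _ x(1)] eq[OF _ _ z(1)] by blast+
      moreover have "\<not> (c \<le> 1 \<and> s = (c = 1))" if "c \<noteq> (if s then 1 else 0)" for c :: nat
        using that by (auto split: if_splits)
      ultimately have "\<not> (larger A y \<le> 1 \<and> s = (larger A y = 1))" "larger A y \<noteq> 2"
        unfolding x(2) z(2) by blast+
      then have "W y = {}"
        unfolding W_def using Cons_in_words_iff[OF _ _ pq] y by blast
      then show "card (W y) = 0" by simp
    qed
  qed (use A x z in auto)
  also have "\<dots> = card (W x) + card (W z)"
    using \<open>x \<noteq> z\<close> by simp
  also have "W x = {xs \<in> permutations_of_set (A - {x}). \<exists>t. xs \<in> words (A - {x}) t p q}"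
    unfolding W_def using x(2) by (simp add: Cons_in_words_iff[OF _ x(1) pq] cong: conj_cong)
  \<comment> \<open>The reset forgets the state of the tail, so both states contribute.\<close>
  also have "\<dots> = words (A - {x}) True p q \<union> words (A - {x}) False p q"
    by (auto simp: words_def)
  also have "card \<dots> = f True p q + f False p q"
    using IH[OF cardB[OF x(1)] pq]
    by (subst card_Un_disjoint) (simp_all add: finite_words, auto simp: words_def)
  also have "W z = {xs \<in> permutations_of_set (A - {z}).
      if s then p \<noteq> 0 \<and> xs \<in> words (A - {z}) s (p - 1) q
      else q \<noteq> 0 \<and> xs \<in> words (A - {z}) s p (q - 1)}"
    unfolding W_def using z(2) by (simp add: Cons_in_words_iff[OF _ z(1) pq] cong: conj_cong)
  also have "\<dots> = (if s then (if p = 0 then {} else words (A - {z}) s (p - 1) q)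
                    else (if q = 0 then {} else words (A - {z}) s p (q - 1)))"
    by (auto simp: words_def)
  also have "card \<dots> = (if s then (if p = 0 then 0 else f s (p - 1) q)
                        else (if q = 0 then 0 else f s p (q - 1)))"
    using IH[OF cardB[OF z(1)]] pq by auto
  finally show ?thesis .
qed

text \<open>Induction from length 2, where there are no triples and each state is realized by
  exactly one word.\<close>

lemma card_words:
  assumes "finite A" "card A = k + 2" "p \<le> 1" "q \<le> 1"
  shows "card (words A s p q) = num_words k s p q"
  using assms
proof (induction k arbitrary: A s p q)
  case 0
  then have "card A = 2" by simp
  then obtain x y where xy: "A = {x, y}" "x \<noteq> y"
    unfolding card_2_iff by blast
  define a b where "a = min x y" and "b = max x y"
  have ab: "A = {a, b}" "a < b"
    using xy by (auto simp: a_def b_def min_def max_def)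
  then have "permutations_of_set A = {[a, b], [b, a]}"
    by (simp add: permutations_of_set_doubleton)
  moreover have "asc [a, b]" "\<not> asc [b, a]" "occ R [a, b] = 0" "occ R [b, a] = 0" for R
    using ab(2) by auto
  ultimately have "words A s p q =
      (if p = 0 \<and> q = 0 then {if s then [a, b] else [b, a]} else {})"
    unfolding words_def by auto
  then show ?case by simp
next
  case (Suc k)
  then show ?case
    using card_words_step[of A "k + 2" p q "num_words k" s] by simp
qed

text \<open>The recurrence closes on four families: no occurrence, one of the type that state
  \<open>s\<close> adds, one of the other type, and one of each. The factors and the added term
  avoid fractions and truncated subtraction.\<close>

lemma num_words_closed_form:
  "num_words (Suc k) s 0 0 = 2 ^ Suc k \<and>
   2 * num_words (Suc k) s (of_bool s) (of_bool (\<not> s)) = (k + 2) * 2 ^ k \<and>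
   2 * num_words (Suc k) s (of_bool (\<not> s)) (of_bool s) = k * 2 ^ k \<and>
   8 * num_words (Suc k) s 1 1 + k * 2 ^ k = k * k * 2 ^ k"
proof (induction k arbitrary: s)
  case 0
  then show ?case by (cases s) auto
next
  case (Suc k)
  show ?case
    using Suc[of True] Suc[of False] num_words.simps(2)[of "Suc k"]
    by (cases s) (simp_all del: num_words.simps add: algebra_simps)
qed

theorem theorem3:
  fixes n :: nat
  assumes "n \<ge> 5"
  shows "card {\<pi>. \<pi> permutes {1..n} \<and>
                   card (occurrences_132 n \<pi>) = 1 \<and>
                   card (occurrences_123 n \<pi>) = 1}
         = (n - 3) * (n - 4) * 2 ^ (n - 5)"
proof -
  obtain j where j: "n = j + 5"
    using assms by (metis add.commute le_Suc_ex)
  let ?F = "\<lambda>\<pi>. map \<pi> [1..<Suc n]"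
  let ?S = "{\<pi>. \<pi> permutes {1..n} \<and> card (occurrences_132 n \<pi>) = 1 \<and> card (occurrences_123 n \<pi>) = 1}"
  have bij: "inj_on ?F {\<pi>. \<pi> permutes {1..n}}"
    "?F ` {\<pi>. \<pi> permutes {1..n}} = permutations_of_set {1..n}"
    using bij_betw_permutes_lists[of n] by (simp_all only: bij_betw_def)
  have "?F ` ?S = {xs \<in> ?F ` {\<pi>. \<pi> permutes {1..n}}. occ (>) xs = 1 \<and> occ (<) xs = 1}"
    unfolding card_occurrences by blast
  also have "\<dots> = words {1..n} True 1 1 \<union> words {1..n} False 1 1"
    unfolding bij(2) by (auto simp: words_def)
  finally have "card (?F ` ?S) = card (words {1..n} True 1 1 \<union> words {1..n} False 1 1)"
    by (rule arg_cong)
  also have "\<dots> = card (words {1..n} True 1 1) + card (words {1..n} False 1 1)"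
    by (rule card_Un_disjoint) (auto simp: finite_words words_def)
  \<comment> \<open>The length \<open>n = j + 5\<close> exceeds the index of
    \<open>num_words\<close> by 2.\<close>
  also have "\<dots> = num_words (Suc (j + 2)) True 1 1 + num_words (Suc (j + 2)) False 1 1"
    using card_words[of "{1..n}" "Suc (j + 2)" 1 1] j by (simp del: num_words.simps)
  \<comment> \<open>With \<open>k = j + 2\<close>, eight times each summand is
    \<open>k * (k - 1) * 2 ^ k\<close>, and the two states double it.\<close>
  also have "\<dots> = (j + 2) * (j + 1) * 2 ^ j"
    using num_words_closed_form[of "j + 2" True] num_words_closed_form[of "j + 2" False]
    by (simp del: num_words.simps add: algebra_simps)
  also have "\<dots> = (n - 3) * (n - 4) * 2 ^ (n - 5)"
    by (simp add: j)
  also have "card (?F ` ?S) = card ?S"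
    by (rule card_image, rule inj_on_subset[OF bij(1)]) blast
  finally show ?thesis .
qed

end
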